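(* Let $ABC$ be any fixed non-degenerate triangle in $\mathbb{E}^3$. Then the closure in $\mathbb{R}^3$ of the set $\Sigma(\triangle ABC)$ is contained in the set $$\mathbb{P}=\left\{(x,y,z)\in [-1,1]^3 \,\mid\, 1+2xyz-x^2-y^2-z^2 \geq 0 \right\}.$$
   Context: For a non-degenerate triangle $ABC$ in Euclidean space $\mathbb{E}^3$, $\Omega(\triangle ABC)$ denotes the set of all tetrahedra $ABCD$ with base $ABC$ and with $D$ lying outside the plane $ABC$. The set $\Sigma(\triangle ABC)$ is $$\Sigma(\triangle ABC)=\left\{(\cos \overline{\alpha},\cos \overline{\beta},\cos \overline{\gamma})\in\mathbb{R}^3 \,\mid\, ABCD \in \Omega (\triangle ABC)\right\},$$ where $\overline{\alpha}=\angle BDC$, $\overline{\beta}=\angle ADC$, $\overline{\gamma}=\angle ADB$. *)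

theory Defs
  imports "HOL-Analysis.Analysis"
begin

text \<open>
  The angle \<open>\<angle>PQR\<close> with vertex \<open>Q\<close>, a real number in \<open>[0, pi]\<close>. It is the
  geometric angle whenever \<open>P \<noteq> Q\<close> and \<open>R \<noteq> Q\<close>; otherwise division by zero makes it
  \<open>pi / 2\<close>, a case that cannot occur at the apex of a tetrahedron.
\<close>

definition angle :: "real^3 \<Rightarrow> real^3 \<Rightarrow> real^3 \<Rightarrow> real" where
  "angle P Q R = arccos (((P - Q) \<bullet> (R - Q)) / (norm (P - Q) * norm (R - Q)))"

text \<open>
  A tetrahedron is represented by its ordered quadruple of vertices, so that the three plane angles
  at the apex can be told apart.
\<close>

definition Omega :: "real^3 \<Rightarrow> real^3 \<Rightarrow> real^3 \<Rightarrow> ((real^3) \<times> (real^3) \<times> (real^3) \<times> (real^3)) set" where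
  "Omega A B C = {(A, B, C, D) |D. D \<notin> affine hull {A, B, C}}"

definition Sigma_set :: "real^3 \<Rightarrow> real^3 \<Rightarrow> real^3 \<Rightarrow> (real \<times> real \<times> real) set" where
  "Sigma_set A B C =
     {(cos (angle B D C), cos (angle A D C), cos (angle A D B)) |D. (A, B, C, D) \<in> Omega A B C}"

definition PP :: "(real \<times> real \<times> real) set" where
  "PP = {(x, y, z). x \<in> {-1..1} \<and> y \<in> {-1..1} \<and> z \<in> {-1..1} \<and>
           1 + 2 * x * y * z - x\<^sup>2 - y\<^sup>2 - z\<^sup>2 \<ge> 0}"

end

theory Submission
  imports Defs
begin

text \<open>
  The expression \<open>1 + 2 x y z - x\<^sup>2 - y\<^sup>2 - z\<^sup>2\<close> is the Gram determinant of the unit vectors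
  from the apex towards \<open>A\<close>, \<open>B\<close> and \<open>C\<close>, hence it is non-negative; and \<open>PP\<close> is closed.
\<close>

text \<open>
  The inequality is Cauchy--Schwarz for the components of \<open>v\<close> and \<open>w\<close> orthogonal to \<open>u\<close>.
\<close>

lemma gram_det_unit_vectors_nonneg:
  fixes u v w :: "'a::real_inner"
  assumes "norm u = 1" "norm v = 1" "norm w = 1"
  shows "1 + 2 * (v \<bullet> w) * (u \<bullet> w) * (u \<bullet> v) - (v \<bullet> w)\<^sup>2 - (u \<bullet> w)\<^sup>2 - (u \<bullet> v)\<^sup>2 \<ge> 0"
proof -
  have unit: "u \<bullet> u = 1" "v \<bullet> v = 1" "w \<bullet> w = 1"
    using assms by (simp_all add: dot_square_norm)
  define p where "p = v - (u \<bullet> v) *\<^sub>R u"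
  define q where "q = w - (u \<bullet> w) *\<^sub>R u"
  have "p \<bullet> q = v \<bullet> w - (u \<bullet> v) * (u \<bullet> w)"
    "p \<bullet> p = 1 - (u \<bullet> v)\<^sup>2" "q \<bullet> q = 1 - (u \<bullet> w)\<^sup>2"
    by (simp_all add: p_def q_def unit inner_diff_left inner_diff_right inner_commute
        power2_eq_square)
  then have "(v \<bullet> w - (u \<bullet> v) * (u \<bullet> w))\<^sup>2 \<le> (1 - (u \<bullet> v)\<^sup>2) * (1 - (u \<bullet> w)\<^sup>2)"
    using Cauchy_Schwarz_ineq[of p q] by simp
  \<comment> \<open>After expansion \<open>(u \<bullet> v)\<^sup>2 * (u \<bullet> w)\<^sup>2\<close>
    cancels, and right side minus left side is the Gram determinant.\<close>
  then show ?thesis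
    by (simp add: power2_eq_square algebra_simps)
qed

text \<open>The argument of \<open>arccos\<close> is an inner product of normalised vectors, so it
  lies in [-1, 1], where \<open>cos\<close> undoes \<open>arccos\<close>. If \<open>P = Q\<close> or
  \<open>R = Q\<close>, both sides are 0.\<close>

lemma cos_angle: "cos (angle P Q R) = sgn (P - Q) \<bullet> sgn (R - Q)"
proof -
  have "\<bar>sgn (P - Q) \<bullet> sgn (R - Q)\<bar> \<le> norm (sgn (P - Q)) * norm (sgn (R - Q))"
    by (rule Cauchy_Schwarz_ineq2)
  also have "\<dots> \<le> 1"
    by (simp add: norm_sgn)
  finally have "cos (arccos (sgn (P - Q) \<bullet> sgn (R - Q))) = sgn (P - Q) \<bullet> sgn (R - Q)"
    by (rule cos_arccos_abs)
  moreover have "sgn (P - Q) \<bullet> sgn (R - Q) = ((P - Q) \<bullet> (R - Q)) / (norm (P - Q) * norm (R - Q))"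
    by (simp add: sgn_div_norm divide_simps)
  ultimately show ?thesis
    by (simp add: angle_def)
qed

lemma Sigma_set_subset_PP: "Sigma_set A B C \<subseteq> PP"
proof
  fix t assume "t \<in> Sigma_set A B C"
  then obtain D where D: "D \<notin> affine hull {A, B, C}"
    and t: "t = (cos (angle B D C), cos (angle A D C), cos (angle A D B))"
    unfolding Sigma_set_def Omega_def by blast
  have "A \<noteq> D" "B \<noteq> D" "C \<noteq> D"
    using D by (auto intro: hull_inc)
  then have "norm (sgn (A - D)) = 1" "norm (sgn (B - D)) = 1" "norm (sgn (C - D)) = 1"
    by (simp_all add: norm_sgn)
  \<comment> \<open>With \<open>u\<close>, \<open>v\<close>, \<open>w\<close> pointing from
    \<open>D\<close> to \<open>A\<close>, \<open>B\<close>, \<open>C\<close>, the products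
    \<open>v \<bullet> w\<close>, \<open>u \<bullet> w\<close>, \<open>u \<bullet> v\<close> are the
    entries of \<open>t\<close> in order.\<close>
  from gram_det_unit_vectors_nonneg[OF this] show "t \<in> PP"
    by (simp add: t PP_def flip: cos_angle)
qed

lemma closed_PP: "closed PP"
proof -
  \<comment> \<open>Projections of a single \<open>p\<close> replace the tuple pattern, so both
    sides of the inequality are visibly continuous in \<open>p\<close>.\<close>
  have "PP = ({-1..1} \<times> {-1..1} \<times> {-1..1}) \<inter>
      {p. 0 \<le> 1 + 2 * fst p * fst (snd p) * snd (snd p)
        - (fst p)\<^sup>2 - (fst (snd p))\<^sup>2 - (snd (snd p))\<^sup>2}"
    by (auto simp: PP_def)
  also have "closed \<dots>"
    by (intro closed_Int closed_Times closed_atLeastAtMost closed_Collect_le continuous_intros)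
  finally show ?thesis .
qed

theorem theorem1:
  fixes A B C :: "real^3"
  assumes "\<not> collinear {A, B, C}"
  shows "closure (Sigma_set A B C) \<subseteq> PP"
  using Sigma_set_subset_PP closed_PP by (rule closure_minimal)

end
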